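(* Let $E$ be a Banach space and let $\tau$ be a Hausdorff topology on $E$. Let $\{ T(t) : t \geq 0 \}$ be a one-parameter $\tau$-continuous semigroup of mappings on a subset $C$ of $E$. Let $\alpha$ and $\beta$ be positive real numbers satisfying $\alpha/\beta \notin \mathbb{Q}$. Then $$ \bigcap_{t \geq 0} F \big( T(t) \big) = F \big( T(\alpha) \big) \cap F \big( T(\beta) \big) $$ holds.
   Context: For a mapping $S : C \to C$, $F(S) = \{x \in C : Sx = x\}$ denotes its set of fixed points. Let $C$ be a subset of a Banach space $E$ and let $\tau$ be a Hausdorff topology on $E$ (not necessarily the norm topology). A family $\{T(t) : t \geq 0\}$ of mappings from $C$ into $C$ is called a one-parameter $\tau$-continuous semigroup of mappings on $C$ if: (sg 1) $T(s+t) = T(s) \circ T(t)$ for all $s, t \geq 0$; (sg 2) for each $x \in C$, the mapping $t \mapsto T(t)x$ from $[0,\infty)$ into $C$ is continuous with respect to $\tau$. (It is not required that $T(0)$ be the identity mapping.) $\mathbb{Q}$ is the set of rational numbers. *)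

theory Defs
  imports "HOL-Analysis.Analysis"
begin

definition fixed_points :: "'a set \<Rightarrow> ('a \<Rightarrow> 'a) \<Rightarrow> 'a set" where
  "fixed_points C S = {x \<in> C. S x = x}"

text \<open>
  Mappings of \<open>C\<close> into itself are total functions whose values matter only on \<open>C\<close>, and
  \<open>T t\<close> matters only for \<open>t \<ge> 0\<close>. No condition is imposed on \<open>T 0\<close> beyond the
  semigroup law. The topology \<open>\<tau>\<close> is independent of the topology of the type.
\<close>

definition one_parameter_semigroup ::
  "'a topology \<Rightarrow> 'a set \<Rightarrow> (real \<Rightarrow> 'a \<Rightarrow> 'a) \<Rightarrow> bool" where
  "one_parameter_semigroup \<tau> C T \<longleftrightarrow>
     (\<forall>t\<ge>0. T t \<in> C \<rightarrow> C) \<and>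
     (\<forall>s\<ge>0. \<forall>t\<ge>0. \<forall>x\<in>C. T (s + t) x = (T s \<circ> T t) x) \<and>
     (\<forall>x\<in>C. continuous_map (top_of_set {0..}) (subtopology \<tau> C) (\<lambda>t. T t x))"

end

theory Submission
  imports Defs
begin

text \<open>
  For a common fixed point \<open>x\<close> of \<open>T \<alpha>\<close> and \<open>T \<beta>\<close>, the orbit \<open>t \<mapsto> T t x\<close> on \<open>[0, \<infinity>)\<close> has
  periods \<open>\<alpha>\<close> and \<open>\<beta>\<close>, so it takes the value \<open>x\<close> at every non-negative integer combination
  \<open>k \<alpha> - h \<beta>\<close>. By Kronecker's theorem these are dense in \<open>[0, \<infinity>)\<close>, and the set where the orbit
  equals \<open>x\<close> is closed because \<open>\<tau>\<close> is Hausdorff.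
\<close>

lemma semigroup_periodic_orbit:
  assumes sg: "one_parameter_semigroup \<tau> C T" and x: "x \<in> fixed_points C (T a)"
    and "a \<ge> 0" "s \<ge> 0"
  shows "T (s + real n * a) x = T s x"
proof (induction n)
  case (Suc n)
  have "T (s + real (Suc n) * a) x = T ((s + real n * a) + a) x"
    by (simp add: algebra_simps)
  also have "\<dots> = T (s + real n * a) (T a x)"
    using sg x \<open>a \<ge> 0\<close> \<open>s \<ge> 0\<close>
    by (simp add: one_parameter_semigroup_def fixed_points_def)
  also have "\<dots> = T s x"
    using x Suc by (simp add: fixed_points_def)
  finally show ?case .
qed simp

text \<open>\<open>T 0\<close> need not be the identity, but
  \<open>T 0 x = T (0 + a) x = T a x = x\<close> by periodicity.\<close>

lemma semigroup_zero_fixed: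
  assumes sg: "one_parameter_semigroup \<tau> C T" and x: "x \<in> fixed_points C (T a)" and "a \<ge> 0"
  shows "T 0 x = x"
  using semigroup_periodic_orbit[OF sg x \<open>a \<ge> 0\<close>, of 0 1] x by (simp add: fixed_points_def)

lemma semigroup_int_comb_fixed:
  assumes sg: "one_parameter_semigroup \<tau> C T"
    and x: "x \<in> fixed_points C (T a)" "x \<in> fixed_points C (T b)"
    and nonneg: "a \<ge> 0" "b \<ge> 0" "of_int k * a - of_int h * b \<ge> 0"
  shows "T (of_int k * a - of_int h * b) x = x"
proof -
  define s where "s = of_int k * a - of_int h * b"
  have s: "s \<ge> 0"
    using nonneg by (simp add: s_def)
  have nat_parts: "of_int i = real (nat i) - real (nat (- i))" for i :: int
    by (cases "i \<ge> 0") auto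
  \<comment> \<open>The semigroup law covers only non-negative times, so the subtracted multiples
    move to the side of \<open>s\<close>. Each side is then a non-negative start time plus natural
    multiples of the two periods.\<close>
  have eq: "s + real (nat (- k)) * a + real (nat h) * b
      = 0 + real (nat k) * a + real (nat (- h)) * b"
    by (simp add: s_def nat_parts[of k] nat_parts[of h] algebra_simps)
  have "T s x = T (s + real (nat (- k)) * a + real (nat h) * b) x"
    using semigroup_periodic_orbit[OF sg] x nonneg s by simp
  also have "\<dots> = T 0 x"
    unfolding eq using nonneg
    by (subst semigroup_periodic_orbit[OF sg x(2)], simp, simp)
      (rule semigroup_periodic_orbit[OF sg x(1)], auto)
  also have "\<dots> = x"
    by (rule semigroup_zero_fixed[OF sg x(1) nonneg(1)])
  finally show ?thesis
    by (simp add: s_def)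
qed

text \<open>Dividing by \<open>b\<close> reduces this to Kronecker's theorem: the integer multiples
  of the irrational \<open>a / b\<close> are dense modulo 1.\<close>

lemma int_combs_dense_nonneg:
  fixes a b t :: real
  assumes "b > 0" "a / b \<notin> \<rat>" "t \<ge> 0" "\<epsilon> > 0"
  obtains k h :: int
  where "of_int k * a - of_int h * b \<ge> 0" "\<bar>of_int k * a - of_int h * b - t\<bar> < \<epsilon>"
proof -
  have "\<epsilon> / (2 * b) > 0"
    using assms by simp
  \<comment> \<open>Aiming at \<open>t + \<epsilon> / 2\<close> instead of \<open>t\<close> keeps the approximant non-negative.\<close>
  from sequence_of_fractional_parts_is_dense[OF \<open>a / b \<notin> \<rat>\<close> this, where \<alpha> = "(t + \<epsilon> / 2) / b"]
  obtain h k where kh: "\<bar>of_int k * (a / b) - of_int h - (t + \<epsilon> / 2) / b\<bar> < \<epsilon> / (2 * b)"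
    by metis
  have "\<bar>of_int k * a - of_int h * b - (t + \<epsilon> / 2)\<bar>
      = \<bar>of_int k * (a / b) - of_int h - (t + \<epsilon> / 2) / b\<bar> * b"
    using \<open>b > 0\<close> by (simp add: abs_mult_pos' mult.commute[of _ b] right_diff_distrib)
  also have "\<dots> < \<epsilon> / (2 * b) * b"
    using kh \<open>b > 0\<close> by (rule mult_strict_right_mono)
  also have "\<dots> = \<epsilon> / 2"
    using \<open>b > 0\<close> by simp
  finally have "\<bar>of_int k * a - of_int h * b - (t + \<epsilon> / 2)\<bar> < \<epsilon> / 2" .
  with \<open>t \<ge> 0\<close> show ?thesis
    by (intro that[of k h]) linarith+
qed

text \<open>Points are closed in the Hausdorff subspace \<open>C\<close>, so their preimages under
  the continuous orbit are closed in the half-line, which is itself closed in the reals.\<close>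

lemma closed_orbit_level_set:
  assumes sg: "one_parameter_semigroup \<tau> C T" and "Hausdorff_space \<tau>" "topspace \<tau> = UNIV" "x \<in> C"
  shows "closed {t \<in> {0..}. T t x = x}"
proof -
  have cont: "continuous_map (top_of_set {0..}) (subtopology \<tau> C) (\<lambda>t. T t x)"
    using sg \<open>x \<in> C\<close> by (simp add: one_parameter_semigroup_def)
  have "closedin (subtopology \<tau> C) {x}"
    using assms by (intro closedin_Hausdorff_singleton Hausdorff_space_subtopology) auto
  from closedin_continuous_map_preimage[OF cont this]
  have "closedin (top_of_set {0..}) {t \<in> {0..}. T t x = x}"
    by simp
  then show ?thesis
    by (rule closedin_closed_trans) simp
qed

theorem proposition2:
  fixes \<tau> :: "'a::banach topology" and C :: "'a set"
    and T :: "real \<Rightarrow> 'a \<Rightarrow> 'a" and \<alpha> \<beta> :: real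
  assumes "topspace \<tau> = UNIV" and "Hausdorff_space \<tau>"
    and "one_parameter_semigroup \<tau> C T"
    and "\<alpha> > 0" and "\<beta> > 0" and "\<alpha> / \<beta> \<notin> \<rat>"
  shows "(\<Inter>t\<in>{0..}. fixed_points C (T t)) = fixed_points C (T \<alpha>) \<inter> fixed_points C (T \<beta>)"
proof
  show "(\<Inter>t\<in>{0..}. fixed_points C (T t)) \<subseteq> fixed_points C (T \<alpha>) \<inter> fixed_points C (T \<beta>)"
    using \<open>\<alpha> > 0\<close> \<open>\<beta> > 0\<close> by auto
next
  show "fixed_points C (T \<alpha>) \<inter> fixed_points C (T \<beta>) \<subseteq> (\<Inter>t\<in>{0..}. fixed_points C (T t))"
  proof (intro subsetI INT_I)
    fix x and t :: real
    assume "x \<in> fixed_points C (T \<alpha>) \<inter> fixed_points C (T \<beta>)" and "t \<in> {0..}"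
    then have x: "x \<in> fixed_points C (T \<alpha>)" "x \<in> fixed_points C (T \<beta>)" "x \<in> C" and "t \<ge> 0"
      by (auto simp: fixed_points_def)
    let ?S = "{t \<in> {0..}. T t x = x}"
    \<comment> \<open>Approximation takes place among times, in the usual metric of the reals;
      \<open>\<tau>\<close> enters only through the closedness of \<open>?S\<close>.\<close>
    have "\<exists>s\<in>?S. dist s t < \<epsilon>" if eps: "\<epsilon> > 0" for \<epsilon>
    proof -
      obtain k h :: int where kh: "of_int k * \<alpha> - of_int h * \<beta> \<ge> 0"
        "\<bar>of_int k * \<alpha> - of_int h * \<beta> - t\<bar> < \<epsilon>"
        by (rule int_combs_dense_nonneg[OF assms(5,6) \<open>t \<ge> 0\<close> eps])
      moreover have "T (of_int k * \<alpha> - of_int h * \<beta>) x = x"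
        using assms(4,5) by (intro semigroup_int_comb_fixed[OF assms(3) x(1,2)] kh(1)) auto
      ultimately show ?thesis
        by (intro bexI[of _ "of_int k * \<alpha> - of_int h * \<beta>"]) (auto simp: dist_real_def)
    qed
    then have "t \<in> ?S"
      using closed_orbit_level_set[OF assms(3,2,1) x(3)] by (metis (lifting) closed_approachable)
    with x(3) show "x \<in> fixed_points C (T t)"
      by (simp add: fixed_points_def)
  qed
qed

end
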